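(* Let $\mathbf d\in\mathbb{N}_0^n$, $h_1,\ldots,h_r\in\mathbb{Z}[x_1,\ldots,x_n]_{\le\mathbf d}$, $p_1,\ldots,p_r\in\mathbb{Z}_{\ge2}$, $\mathbf p=(p_1,\ldots,p_r)$, $k=\lceil\log_2(\mathrm{lcm}(p_1,\ldots,p_r))\rceil$, $D=[0,2^k]\times\cdots\times[0,2^k]\subset\mathbb{R}^n$, and let $v$ be the matrix associated to $h_1,\ldots,h_r$ over $D$. Then the output of SolveCE$(\mathbf p,v,(k,\ldots,k),(0,\ldots,0))$ is the set \[ \mathcal S'=\{\mathbf z\in D\cap\mathbb{Z}^n\,\colon\, p_1\mid h_1(\mathbf z),\ldots,p_r\mid h_r(\mathbf z)\}. \]
   Context: $\mathbb{Z}[x_1,\ldots,x_n]_{\le\mathbf d}$: polynomials of degree at most $d_i$ in $x_i$ for each $i$. Let $s=(d_1+1)\cdots(d_n+1)$. The $\mathbf d$-Bernstein basis of $\mathbb{R}[\mathbf x]_{\le\mathbf d}$ consists of the $s$ polynomials $\prod_i\binom{d_i}{m_i}x_i^{m_i}(1-x_i)^{d_i-m_i}$, $\mathbf 0\le\mathbf m\le\mathbf d$, in lexicographic order (the index $\mathbf 0$ first). For a box $E=\prod_i[\alpha_i,\beta_i]$ put $\varphi_E(\mathbf x)=(\alpha_i+(\beta_i-\alpha_i)x_i)_i$. The matrix associated to $h_1,\ldots,h_r$ over $D$ is $v\in\mathbb{Q}^{s\times r}$ whose $i$-th column is the coordinate vector of $h_i\circ\varphi_D$ in the $\mathbf d$-Bernstein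 basis. $M_j^L$ (resp. $M_j^R$) $\in\mathbb{Q}^{s\times s}$ is the matrix in the $\mathbf d$-Bernstein basis (acting on column vectors) of $q\mapsto q\circ\varphi_E$ on $\mathbb{R}[\mathbf x]_{\le\mathbf d}$ for $E=[0,1]^{j-1}\times[0,1/2]\times[0,1]^{n-j}$ (resp. $E=[0,1]^{j-1}\times[1/2,1]\times[0,1]^{n-j}$). Function hasSol$(m_1,m_2,p)$ for rationals $m_1\le m_2$ and $p\in\mathbb{Z}_{\ge2}$: replace $(m_1,m_2)$ by $(\lceil m_1\rceil,\lfloor m_2\rfloor)$; let $r_1,r_2\in\{0,\ldots,p-1\}$ be the remainders of $m_1,m_2$ modulo $p$; return False if $m_2-m_1<p-1$ and $0<r_1\le r_2$, otherwise return True. Recursive function SolveCE$(\mathbf p,w,\mathbf k',\mathbf l)$, with a global set $\mathcal S'$ initialized to $\emptyset$; here $w\in\mathbb{Q}^{s\times r}$ has columns $w_1,\ldots,w_r$, $\min(w_i),\max(w_i)$ are the minimum and maximum entries of column $i$, and $e_j$ is the $j$-th canonical vector: - If hasSol$(\min(w_i),\max(w_i),p_i)$ is False for some $i\in\{1,\ldots,r\}$, do nothing. - Otherwise let $j$ be an index with $k_j'=\max(\mathbf k')$. If $k_j'>0$, call SolveCE$(\mathbf p,M_j^Lw,\mathbf k'-e_j,\mathbf l+l_je_j)$ and SolveCE$(\mathbf p,M_j^Rw,\mathbf k'-e_j,\mathbf l+l_je_j+e_j)$. - Otherwise (i.e. $\mathbf k'=\mathbf 0$), if $p_1\mid w_{11}$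 and $\ldots$ and $p_r\mid w_{1r}$, set $\mathcal S':=\mathcal S'\cup\{\mathbf l\}$. The output is the final value of the global set $\mathcal S'$.
   Formalization: The set S' is restricted to points z of D with no coordinate equal to 2^k (half-open cube); as printed the claim fails, e.g. n=r=1, d=1, h_1=x_1, p_1=2: the output is {0}, but z=2 in D=[0,2] also satisfies 2 | h_1(z). *)

theory Defs
  imports Complex_Main "HOL-Library.Poly_Mapping" "Jordan_Normal_Form.Matrix"
begin

text \<open>
  Tuples are lists, and all indices start at 0. A polynomial is a finitely supported map from
  monomials (finitely supported exponent maps) to coefficients; the variables of a polynomial
  in \<open>n\<close> variables are numbered \<open>0, \<dots>, n - 1\<close>.
\<close>

type_synonym 'a mpoly = "(nat \<Rightarrow>\<^sub>0 nat) \<Rightarrow>\<^sub>0 'a"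

definition Const :: "'a::zero \<Rightarrow> 'a mpoly" where
  "Const c = Poly_Mapping.single 0 c"

definition Var :: "nat \<Rightarrow> 'a::zero_neq_one mpoly" where
  "Var i = Poly_Mapping.single (Poly_Mapping.single i 1) 1"

definition mpoly_eval :: "('a::zero \<Rightarrow> 'b::comm_semiring_1) \<Rightarrow> (nat \<Rightarrow> 'b) \<Rightarrow> 'a mpoly \<Rightarrow> 'b" where
  "mpoly_eval f x q =
     (\<Sum>m\<in>Poly_Mapping.keys q.
        f (Poly_Mapping.lookup q m) *
        (\<Prod>i\<in>Poly_Mapping.keys m. x i ^ Poly_Mapping.lookup m i))"

definition eval_int :: "int mpoly \<Rightarrow> int list \<Rightarrow> int" where
  "eval_int h z = mpoly_eval (\<lambda>c. c) (\<lambda>i. z ! i) h"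

definition mpoly_comp :: "real mpoly \<Rightarrow> (nat \<Rightarrow> real mpoly) \<Rightarrow> real mpoly" where
  "mpoly_comp q \<phi> = mpoly_eval Const \<phi> q"

abbreviation real_mpoly :: "int mpoly \<Rightarrow> real mpoly" where
  "real_mpoly h \<equiv> Poly_Mapping.map real_of_int h"

text \<open>
  Polynomials in \<open>length d\<close> variables of degree at most \<open>d ! i\<close> in the variable \<open>i\<close>.
\<close>

definition mpolys_le :: "nat list \<Rightarrow> 'a::zero mpoly set" where
  "mpolys_le d =
     {q. \<forall>m\<in>Poly_Mapping.keys q.
           Poly_Mapping.keys m \<subseteq> {..<length d} \<and>
           (\<forall>i<length d. Poly_Mapping.lookup m i \<le> d ! i)}"


section \<open>Bernstein basis\<close>

text \<open>The multi-indices \<open>0 \<le> m \<le> d\<close> in lexicographic order.\<close>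

fun multi_indices :: "nat list \<Rightarrow> nat list list" where
  "multi_indices [] = [[]]"
| "multi_indices (d # ds) =
     concat (map (\<lambda>m. map ((#) m) (multi_indices ds)) [0..<Suc d])"

lemma set_multi_indices:
  "set (multi_indices d) = {m. length m = length d \<and> (\<forall>i<length d. m ! i \<le> d ! i)}"
proof (induction d)
  case Nil
  then show ?case by auto
next
  case (Cons a d)
  show ?case
  proof (intro equalityI subsetI)
    fix m assume "m \<in> set (multi_indices (a # d))"
    then show "m \<in> {m. length m = length (a # d) \<and> (\<forall>i<length (a # d). m ! i \<le> (a # d) ! i)}"
      using Cons by (fastforce simp: nth_Cons split: nat.splits)
  next
    fix m assume m: "m \<in> {m. length m = length (a # d) \<and> (\<forall>i<length (a # d). m ! i \<le> (a # d) ! i)}"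
    then obtain b m' where mb: "m = b # m'" by (cases m) auto
    have "b \<le> a" using m mb by fastforce
    moreover have "m' \<in> set (multi_indices d)" using m mb Cons by fastforce
    ultimately show "m \<in> set (multi_indices (a # d))"
      using mb by (cases "b = a") auto
  qed
qed

lemma length_multi_indices: "length (multi_indices d) = (\<Prod>x\<leftarrow>d. x + 1)"
  by (induction d) (auto simp: length_concat comp_def sum_list_triv)

lemma sorted_multi_indices:
  "sorted_wrt (\<lambda>m m'. (m, m') \<in> lexord {(x, y). x < y}) (multi_indices d)"
proof (induction d)
  case Nil
  then show ?case by simp
next
  case (Cons a d)
  have "sorted_wrt (\<lambda>m m'. (m, m') \<in> lexord {(x, y). x < y})
          (concat (map (\<lambda>m. map ((#) m) (multi_indices d)) [0..<k]))" for k
    by (induction k) (auto simp: sorted_wrt_append sorted_wrt_map Cons)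
  from this[of "Suc a"] show ?case by simp
qed

definition bernstein :: "nat list \<Rightarrow> nat list \<Rightarrow> real mpoly" where
  "bernstein d m =
     (\<Prod>i<length d. Const (real (d ! i choose m ! i)) * Var i ^ (m ! i) * (1 - Var i) ^ (d ! i - m ! i))"

definition bdim :: "nat list \<Rightarrow> nat" where
  "bdim d = (\<Prod>x\<leftarrow>d. x + 1)"

definition bernstein_basis :: "nat list \<Rightarrow> nat \<Rightarrow> real mpoly" where
  "bernstein_basis d a = bernstein d (multi_indices d ! a)"

text \<open>
  The basis spans a space of real polynomials, but coordinates are taken in the rationals; all
  polynomials to which this is applied below have rational coordinates.
\<close>

definition bernstein_coords :: "nat list \<Rightarrow> real mpoly \<Rightarrow> rat vec" where
  "bernstein_coords d q =
     (THE c. c \<in> carrier_vec (bdim d) \<and>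
             q = (\<Sum>a<bdim d. Const (of_rat (c $ a)) * bernstein_basis d a))"


section \<open>Boxes and the associated matrices\<close>

text \<open>The box with sides \<open>[\<alpha>, \<beta>]\<close> is given by the list of the pairs \<open>(\<alpha>, \<beta>)\<close>.\<close>

type_synonym box = "(real \<times> real) list"

definition box_points :: "box \<Rightarrow> real list set" where
  "box_points E = {x. length x = length E \<and> (\<forall>i<length E. fst (E ! i) \<le> x ! i \<and> x ! i \<le> snd (E ! i))}"

definition box_map :: "box \<Rightarrow> nat \<Rightarrow> real mpoly" where
  "box_map E i = Const (fst (E ! i)) + Const (snd (E ! i) - fst (E ! i)) * Var i"

definition assoc_mat :: "nat list \<Rightarrow> box \<Rightarrow> int mpoly list \<Rightarrow> rat mat" where
  "assoc_mat d D hs =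
     mat (bdim d) (length hs)
       (\<lambda>(a, i). bernstein_coords d (mpoly_comp (real_mpoly (hs ! i)) (box_map D)) $ a)"

definition subst_mat :: "nat list \<Rightarrow> box \<Rightarrow> rat mat" where
  "subst_mat d E =
     mat (bdim d) (bdim d)
       (\<lambda>(a, b). bernstein_coords d (mpoly_comp (bernstein_basis d b) (box_map E)) $ a)"

definition M_left :: "nat list \<Rightarrow> nat \<Rightarrow> rat mat" where
  "M_left d j = subst_mat d ((replicate (length d) (0, 1))[j := (0, 1/2)])"

definition M_right :: "nat list \<Rightarrow> nat \<Rightarrow> rat mat" where
  "M_right d j = subst_mat d ((replicate (length d) (0, 1))[j := (1/2, 1)])"


section \<open>The algorithm\<close>

definition hasSol :: "rat \<Rightarrow> rat \<Rightarrow> int \<Rightarrow> bool" where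
  "hasSol m\<^sub>1 m\<^sub>2 p =
     (let a = \<lceil>m\<^sub>1\<rceil>; b = \<lfloor>m\<^sub>2\<rfloor>; r\<^sub>1 = a mod p; r\<^sub>2 = b mod p
      in \<not> (b - a < p - 1 \<and> 0 < r\<^sub>1 \<and> r\<^sub>1 \<le> r\<^sub>2))"

definition all_hasSol :: "int list \<Rightarrow> rat mat \<Rightarrow> bool" where
  "all_hasSol ps w \<longleftrightarrow>
     (\<forall>i<length ps. hasSol (Min (vec_set (col w i))) (Max (vec_set (col w i))) (ps ! i))"

text \<open>Divisibility in the integers of a rational number (\<open>dvd\<close> on a field is trivial).\<close>

definition int_dvd_rat :: "int \<Rightarrow> rat \<Rightarrow> bool" where
  "int_dvd_rat p x \<longleftrightarrow> (\<exists>y::int. x = of_int y \<and> p dvd y)"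

text \<open>
  \<open>SolveCE d ps w k l S S'\<close>: the call with arguments \<open>ps\<close>, \<open>w\<close>, \<open>k\<close>, \<open>l\<close>, started when the
  global set is \<open>S\<close>, can terminate with the global set \<open>S'\<close>. It is a relation because the
  algorithm may choose any index \<open>j\<close> at which \<open>k\<close> is maximal, independently in each call.
\<close>

inductive SolveCE ::
  "nat list \<Rightarrow> int list \<Rightarrow> rat mat \<Rightarrow> nat list \<Rightarrow> int list \<Rightarrow> int list set \<Rightarrow> int list set \<Rightarrow> bool"
  for d :: "nat list" and ps :: "int list"
where
  prune:
    "\<not> all_hasSol ps w \<Longrightarrow> SolveCE d ps w k l S S"
| split:
    "\<lbrakk> all_hasSol ps w; j < length k; k ! j = Max (set k); k ! j > 0;
       SolveCE d ps (M_left d j * w) (k[j := k ! j - 1]) (l[j := l ! j + l ! j]) S S';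
       SolveCE d ps (M_right d j * w) (k[j := k ! j - 1]) (l[j := l ! j + l ! j + 1]) S' S'' \<rbrakk>
     \<Longrightarrow> SolveCE d ps w k l S S''"
| accept:
    "\<lbrakk> all_hasSol ps w; \<forall>x\<in>set k. x = 0; \<forall>i<length ps. int_dvd_rat (ps ! i) (w $$ (0, i)) \<rbrakk>
     \<Longrightarrow> SolveCE d ps w k l S (S \<union> {l})"
| reject:
    "\<lbrakk> all_hasSol ps w; \<forall>x\<in>set k. x = 0; \<not> (\<forall>i<length ps. int_dvd_rat (ps ! i) (w $$ (0, i))) \<rbrakk>
     \<Longrightarrow> SolveCE d ps w k l S S"

end

theory Submission
  imports Defs
begin

text \<open>
  A call of the algorithm is responsible for the integer points of a half-open dyadic cell, whose
  sides are \<open>[2\<^sup>k l, 2\<^sup>k (l + 1))\<close> with \<open>k\<close> and \<open>l\<close> depending on the variable. The invariant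
  \<open>represents\<close> says that the columns of the current matrix are the Bernstein coordinates of the
  polynomials \<open>h\<^sub>i\<close> on the closure of this cell. Under the invariant every run adds exactly the
  solutions in its cell (\<open>SolveCE_result\<close>), for three reasons.

  First, the Bernstein polynomials are nonnegative on the unit cube and sum to \<open>1\<close>, so the
  values of \<open>h\<^sub>i\<close> on the cell lie between the smallest and the largest entry of column \<open>i\<close>. When
  \<open>hasSol\<close> rejects this range, it contains no multiple of \<open>p\<^sub>i\<close>, and the cell has no solution
  (\<open>all_hasSol_if_solution\<close>).
  Second, multiplication by \<open>M_left\<close> or \<open>M_right\<close> passes to one half of the cell, which preserves
  the invariant (\<open>represents_half\<close>), and the two half-open halves partition the cell
  (\<open>cell_split\<close>).
  Third, a cell of side \<open>1\<close> has \<open>l\<close> as its only integer point, and the first Bernstein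
  coordinate of \<open>h\<^sub>i\<close> is its value at this corner, so the final test decides whether \<open>l\<close> is a
  solution (\<open>int_dvd_rat_corner\<close>).
  Since each bisection lowers the sum of the exponents, a run always exists
  (\<open>SolveCE_terminates\<close>), and all runs have the same output.

  The invariant speaks about values of functions, whereas the matrices are defined by coordinates.
  The link is that the coordinates exist, are rational and are unique
  (\<open>bernstein_coords_eq\<close>). For existence, an affine polynomial in one
  variable \<open>X\<close> is a linear form in \<open>X\<close> and \<open>1 - X\<close>, so powers of affine polynomials, filled up by
  factors \<open>1 = X + (1 - X)\<close>, are forms of the required degree, that is, combinations of Bernstein
  polynomials; products over the variables give the multivariate case. For uniqueness, the
  substitution \<open>x = t / (1 + t)\<close> turns the Bernstein polynomials into monomials in \<open>t\<close> with a common
  denominator.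
\<close>

section \<open>Evaluation of polynomials\<close>

lemma Const_0: "Const 0 = 0"
  by (simp add: Const_def)

lemma Const_1: "Const 1 = 1"
  by (simp add: Const_def)

lemma Const_add: "Const (a + b) = Const a + Const (b :: 'a::monoid_add)"
  by (simp add: Const_def single_add)

lemma Const_diff: "Const (a - b) = Const a - Const (b :: 'a::ab_group_add)"
  by (simp add: Const_def single_diff)

lemma Const_mult: "Const (a * b) = Const a * Const (b :: 'a::semiring_0)"
  by (simp add: Const_def mult_single)

lemma Const_prod: "Const (prod f A) = (\<Prod>x\<in>A. Const (f x :: 'a::comm_semiring_1))"
  by (induction A rule: infinite_finite_induct) (auto simp: Const_1 Const_mult)

text \<open>
  Evaluation is needed for three coefficient maps: the identity (values at real points), the
  embedding of the integers into the reals, and \<open>Const\<close> (substitution of polynomials). For the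
  first and the last it has to respect products, which holds whenever the coefficient map is a
  ring homomorphism.
\<close>

locale coeff_hom =
  fixes f :: "'a::comm_ring_1 \<Rightarrow> 'b::comm_ring_1"
  assumes hom_0: "f 0 = 0" and hom_1: "f 1 = 1"
    and hom_add: "f (a + b) = f a + f b" and hom_mult: "f (a * b) = f a * f b"
begin

lemma eval_0: "mpoly_eval f x 0 = 0"
  by (simp add: mpoly_eval_def)

lemma eval_add: "mpoly_eval f x (p + q) = mpoly_eval f x p + mpoly_eval f x q"
  unfolding mpoly_eval_def
  by (rule setsum_keys_plus_distrib) (simp_all add: hom_0 hom_add distrib_right)

lemma eval_sum: "mpoly_eval f x (sum g A) = (\<Sum>a\<in>A. mpoly_eval f x (g a))"
  by (induction A rule: infinite_finite_induct) (simp_all add: eval_0 eval_add)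

lemma eval_single:
  "mpoly_eval f x (Poly_Mapping.single m c) =
     f c * (\<Prod>i\<in>Poly_Mapping.keys m. x i ^ Poly_Mapping.lookup m i)"
  by (simp add: mpoly_eval_def hom_0)

lemma eval_Const: "mpoly_eval f x (Const c) = f c"
  by (simp add: Const_def eval_single)

lemma eval_Var: "mpoly_eval f x (Var i) = x i"
  by (simp add: Var_def eval_single hom_1)

lemma eval_1: "mpoly_eval f x 1 = 1"
  using eval_Const[of x 1] by (simp add: Const_1 hom_1)

lemma monomial_value_add:
  fixes x :: "nat \<Rightarrow> 'b"
  shows "(\<Prod>i\<in>Poly_Mapping.keys (m + m'). x i ^ Poly_Mapping.lookup (m + m') i) =
         (\<Prod>i\<in>Poly_Mapping.keys m. x i ^ Poly_Mapping.lookup m i) *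
         (\<Prod>i\<in>Poly_Mapping.keys m'. x i ^ Poly_Mapping.lookup m' i)"
proof -
  let ?K = "Poly_Mapping.keys m \<union> Poly_Mapping.keys m'"
  have ext: "(\<Prod>i\<in>Poly_Mapping.keys p. x i ^ Poly_Mapping.lookup p i) =
             (\<Prod>i\<in>?K. x i ^ Poly_Mapping.lookup p i)" if "Poly_Mapping.keys p \<subseteq> ?K" for p
    by (rule prod.mono_neutral_left) (use that in \<open>auto simp: in_keys_iff\<close>)
  have "(\<Prod>i\<in>Poly_Mapping.keys (m + m'). x i ^ Poly_Mapping.lookup (m + m') i) =
        (\<Prod>i\<in>?K. x i ^ Poly_Mapping.lookup (m + m') i)"
    by (rule ext[OF keys_add])
  also have "\<dots> = (\<Prod>i\<in>?K. x i ^ Poly_Mapping.lookup m i) * (\<Prod>i\<in>?K. x i ^ Poly_Mapping.lookup m' i)"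
    by (simp only: lookup_add power_add prod.distrib)
  finally show ?thesis
    by (simp only: ext[OF Un_upper1] ext[OF Un_upper2])
qed

lemma eval_mult: "mpoly_eval f x (p * q) = mpoly_eval f x p * mpoly_eval f x q"
proof -
  have expand: "g = (\<Sum>m\<in>Poly_Mapping.keys g. Poly_Mapping.single m (Poly_Mapping.lookup g m))"
    for g :: "'a mpoly"
    by (rule poly_mapping_eqI)
       (auto simp: lookup_sum lookup_single when_def in_keys_iff sum.delta')
  have single: "mpoly_eval f x (Poly_Mapping.single m a * Poly_Mapping.single m' b) =
        mpoly_eval f x (Poly_Mapping.single m a) * mpoly_eval f x (Poly_Mapping.single m' b)"
    for m m' a b
    by (simp add: mult_single eval_single hom_mult monomial_value_add)
  have "mpoly_eval f x
          ((\<Sum>m\<in>Poly_Mapping.keys p. Poly_Mapping.single m (Poly_Mapping.lookup p m)) *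
           (\<Sum>m\<in>Poly_Mapping.keys q. Poly_Mapping.single m (Poly_Mapping.lookup q m))) =
        mpoly_eval f x (\<Sum>m\<in>Poly_Mapping.keys p. Poly_Mapping.single m (Poly_Mapping.lookup p m)) *
        mpoly_eval f x (\<Sum>m\<in>Poly_Mapping.keys q. Poly_Mapping.single m (Poly_Mapping.lookup q m))"
    by (simp only: sum_product eval_sum single)
  then show ?thesis
    by (simp only: expand[symmetric])
qed

lemma eval_prod: "mpoly_eval f x (prod g A) = (\<Prod>a\<in>A. mpoly_eval f x (g a))"
  by (induction A rule: infinite_finite_induct) (simp_all add: eval_1 eval_mult)

lemma eval_power: "mpoly_eval f x (p ^ e) = mpoly_eval f x p ^ e"
  by (induction e) (simp_all add: eval_1 eval_mult)

lemma eval_one_minus: "mpoly_eval f x (1 - p) = 1 - mpoly_eval f x p"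
  using eval_add[of x "1 - p" p] by (simp add: eval_1 eq_diff_eq)

end

interpretation real_eval: coeff_hom "\<lambda>c. c :: real"
  by standard auto

interpretation comp_eval: coeff_hom "Const :: real \<Rightarrow> real mpoly"
  by standard (simp_all add: Const_0 Const_1 Const_add Const_mult)

abbreviation reval :: "(nat \<Rightarrow> real) \<Rightarrow> real mpoly \<Rightarrow> real" where
  "reval \<equiv> mpoly_eval (\<lambda>c. c)"

lemma reval_mpoly_comp: "reval x (mpoly_comp q \<phi>) = reval (\<lambda>i. reval x (\<phi> i)) q"
  unfolding mpoly_comp_def mpoly_eval_def[of Const] mpoly_eval_def[of _ "\<lambda>i. reval x (\<phi> i)"]
  by (simp add: real_eval.eval_sum real_eval.eval_mult real_eval.eval_prod real_eval.eval_power
      real_eval.eval_Const)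

lemma reval_box_map:
  "reval x (box_map E i) = fst (E ! i) + (snd (E ! i) - fst (E ! i)) * x i"
  by (simp add: box_map_def real_eval.eval_add real_eval.eval_mult real_eval.eval_Const
      real_eval.eval_Var)

abbreviation ieval :: "(nat \<Rightarrow> real) \<Rightarrow> int mpoly \<Rightarrow> real" where
  "ieval \<equiv> mpoly_eval real_of_int"

lemma keys_real_mpoly: "Poly_Mapping.keys (real_mpoly h) = Poly_Mapping.keys h"
  by (auto simp: in_keys_iff Poly_Mapping.map.rep_eq when_def)

lemma lookup_real_mpoly:
  "Poly_Mapping.lookup (real_mpoly h) m = real_of_int (Poly_Mapping.lookup h m)"
  by (auto simp: Poly_Mapping.map.rep_eq when_def)

lemma reval_real_mpoly: "reval x (real_mpoly h) = ieval x h"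
  by (simp add: mpoly_eval_def keys_real_mpoly lookup_real_mpoly)

lemma ieval_of_int: "ieval (\<lambda>i. real_of_int (z ! i)) h = real_of_int (eval_int h z)"
  by (simp add: mpoly_eval_def eval_int_def)

lemma ieval_cong:
  assumes "h \<in> mpolys_le d" "\<And>i. i < length d \<Longrightarrow> x i = y i"
  shows "ieval x h = ieval y h"
  unfolding mpoly_eval_def
  using assms by (intro sum.cong refl arg_cong2[of _ _ _ _ "(*)"] prod.cong)
    (auto simp: mpolys_le_def subset_iff)

section \<open>Polynomials with rational Bernstein coordinates\<close>

text \<open>
  The polynomials are real but their coordinates are rational, so scalars are rational constants
  inside the ring of real polynomials.
\<close>

abbreviation rat_const :: "rat \<Rightarrow> real mpoly" where
  "rat_const a \<equiv> Const (of_rat a)"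

text \<open>
  The rational forms of degree \<open>e\<close> in \<open>X\<close> and \<open>1 - X\<close>. Up to the binomial factors the generators are
  the univariate Bernstein polynomials of degree \<open>e\<close>; without these factors, multiplication by
  \<open>X\<close> shifts the coefficients by one and multiplication by \<open>1 - X\<close> keeps them.
\<close>

definition homog_comb :: "nat \<Rightarrow> real mpoly \<Rightarrow> real mpoly set" where
  "homog_comb e X = {q. \<exists>c. q = (\<Sum>m\<le>e. rat_const (c m) * (X ^ m * (1 - X) ^ (e - m)))}"

text \<open>
  An affine polynomial \<open>a + b X\<close> is the linear form \<open>a (1 - X) + (a + b) X\<close>, so multiplying by it
  raises the degree of a form by one.
\<close>

lemma homog_comb_mult_affine:
  assumes "q \<in> homog_comb e X"
  shows "(rat_const a + rat_const b * X) * q \<in> homog_comb (Suc e) X"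
proof -
  obtain c where c: "q = (\<Sum>m\<le>e. rat_const (c m) * (X ^ m * (1 - X) ^ (e - m)))"
    using assms by (auto simp: homog_comb_def)
  \<comment> \<open>The coefficients contributed by \<open>a (1 - X)\<close> and, shifted by one, by \<open>(a + b) X\<close>.\<close>
  define c1 c2 where "c1 m = (if m \<le> e then a * c m else 0)"
    and "c2 m = (case m of 0 \<Rightarrow> 0 | Suc m \<Rightarrow> (a + b) * c m)" for m
  have 1: "rat_const a * (1 - X) * q = (\<Sum>m\<le>Suc e. rat_const (c1 m) * (X ^ m * (1 - X) ^ (Suc e - m)))"
    by (simp add: c1_def c Const_0 sum_distrib_left of_rat_mult Const_mult Suc_diff_le mult_ac)
  have 2: "rat_const (a + b) * X * q = (\<Sum>m\<le>Suc e. rat_const (c2 m) * (X ^ m * (1 - X) ^ (Suc e - m)))"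
    by (subst sum.atMost_Suc_shift)
       (simp add: c2_def c Const_0 sum_distrib_left of_rat_mult Const_mult mult_ac)
  have "(rat_const a + rat_const b * X) * q = rat_const a * (1 - X) * q + rat_const (a + b) * X * q"
    by (simp add: of_rat_add Const_add algebra_simps)
  also have "\<dots> = (\<Sum>m\<le>Suc e. rat_const (c1 m + c2 m) * (X ^ m * (1 - X) ^ (Suc e - m)))"
    unfolding 1 2 by (simp only: of_rat_add Const_add distrib_right sum.distrib)
  finally show ?thesis
    unfolding homog_comb_def by (intro CollectI exI)
qed

text \<open>
  The exponent \<open>t\<close> serves two purposes: with the second factor equal to \<open>1 - (a + b X)\<close> this
  expands a Bernstein polynomial on a subinterval, and with the second factor \<open>1\<close> it raises the
  degree of \<open>(a + b X) ^ s\<close>.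
\<close>

lemma affine_powers_homog_comb:
  "(rat_const a + rat_const b * X) ^ s * (rat_const a' + rat_const b' * X) ^ t \<in> homog_comb (s + t) X"
proof (induction s)
  case 0
  show ?case
  proof (induction t)
    case 0
    show ?case
      unfolding homog_comb_def by (auto intro!: exI[of _ "\<lambda>_. 1"] simp: Const_1)
  next
    case (Suc t)
    then show ?case
      using homog_comb_mult_affine by (simp add: mult.assoc)
  qed
next
  case (Suc s)
  then show ?case
    using homog_comb_mult_affine by (simp add: mult.assoc)
qed

lemma sum_list_multi_indices_Cons:
  fixes f :: "nat list \<Rightarrow> 'a::comm_monoid_add"
  shows "(\<Sum>m\<leftarrow>multi_indices (e # d). f m) = (\<Sum>b\<le>e. \<Sum>m\<leftarrow>multi_indices d. f (b # m))"
proof -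
  have "sum_list (map f (concat (map (\<lambda>m. map ((#) m) (multi_indices d)) [0..<k]))) =
        (\<Sum>b<k. \<Sum>m\<leftarrow>multi_indices d. f (b # m))" for k
    by (induction k) (simp_all add: comp_def)
  from this[of "Suc e"] show ?thesis
    by (simp add: lessThan_Suc_atMost)
qed

lemma prod_sum_multi_indices:
  fixes f :: "nat \<Rightarrow> nat \<Rightarrow> 'a::comm_semiring_1"
  shows "(\<Prod>i<length d. \<Sum>m\<le>d ! i. f i m) = (\<Sum>m\<leftarrow>multi_indices d. \<Prod>i<length d. f i (m ! i))"
proof (induction d arbitrary: f)
  case Nil
  then show ?case by simp
next
  case (Cons e d)
  have "(\<Prod>i<length (e # d). \<Sum>m\<le>(e # d) ! i. f i m) =
        (\<Sum>m\<le>e. f 0 m) * (\<Prod>i<length d. \<Sum>m\<le>d ! i. f (Suc i) m)"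
    by (simp add: prod.lessThan_Suc_shift del: prod.lessThan_Suc)
  also have "\<dots> = (\<Sum>b\<le>e. \<Sum>m\<leftarrow>multi_indices d. f 0 b * (\<Prod>i<length d. f (Suc i) (m ! i)))"
    by (simp only: Cons.IH sum_distrib_right sum_list_const_mult)
  finally show ?case
    by (simp only: sum_list_multi_indices_Cons length_Cons prod.lessThan_Suc_shift
        nth_Cons_0 nth_Cons_Suc)
qed

lemma length_in_multi_indices: "m \<in> set (multi_indices d) \<Longrightarrow> length m = length d"
  and le_in_multi_indices: "m \<in> set (multi_indices d) \<Longrightarrow> i < length d \<Longrightarrow> m ! i \<le> d ! i"
  by (simp_all add: set_multi_indices)

definition bernstein_span :: "nat list \<Rightarrow> real mpoly set" where
  "bernstein_span d = {q. \<exists>c. q = (\<Sum>m\<leftarrow>multi_indices d. rat_const (c m) * bernstein d m)}"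

lemma bernstein_span_add: "p \<in> bernstein_span d \<Longrightarrow> q \<in> bernstein_span d \<Longrightarrow> p + q \<in> bernstein_span d"
proof -
  assume "p \<in> bernstein_span d" "q \<in> bernstein_span d"
  then obtain a b where "p = (\<Sum>m\<leftarrow>multi_indices d. rat_const (a m) * bernstein d m)"
    "q = (\<Sum>m\<leftarrow>multi_indices d. rat_const (b m) * bernstein d m)"
    unfolding bernstein_span_def by blast
  then have "p + q = (\<Sum>m\<leftarrow>multi_indices d. rat_const (a m + b m) * bernstein d m)"
    by (simp add: of_rat_add Const_add distrib_right sum_list_addf)
  then show ?thesis
    unfolding bernstein_span_def by (intro CollectI exI)
qed

lemma bernstein_span_scale: "q \<in> bernstein_span d \<Longrightarrow> rat_const a * q \<in> bernstein_span d"
proof -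
  assume "q \<in> bernstein_span d"
  then obtain b where "q = (\<Sum>m\<leftarrow>multi_indices d. rat_const (b m) * bernstein d m)"
    unfolding bernstein_span_def by blast
  then have "rat_const a * q = (\<Sum>m\<leftarrow>multi_indices d. rat_const (a * b m) * bernstein d m)"
    by (simp add: of_rat_mult Const_mult mult.assoc sum_list_const_mult)
  then show ?thesis
    unfolding bernstein_span_def by (intro CollectI exI)
qed

lemma bernstein_span_0: "0 \<in> bernstein_span d"
  unfolding bernstein_span_def by (intro CollectI exI[of _ "\<lambda>_. 0"]) (simp add: Const_0)

lemma bernstein_span_sum: "(\<And>a. a \<in> A \<Longrightarrow> g a \<in> bernstein_span d) \<Longrightarrow> sum g A \<in> bernstein_span d"
  by (induction A rule: infinite_finite_induct) (auto intro: bernstein_span_0 bernstein_span_add)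

text \<open>
  Expanding a product of univariate forms, one in each variable, gives tensor products of
  univariate Bernstein polynomials. The binomial factors omitted from the univariate forms are
  divided out here; they are positive because \<open>m \<le> d ! i\<close>.
\<close>

lemma prod_homog_comb_in_span:
  assumes "\<And>i. i < length d \<Longrightarrow> u i \<in> homog_comb (d ! i) (Var i)"
  shows "(\<Prod>i<length d. u i) \<in> bernstein_span d"
proof -
  have "\<forall>i\<in>{..<length d}. \<exists>c.
      u i = (\<Sum>m\<le>d ! i. rat_const (c m) * (Var i ^ m * (1 - Var i) ^ (d ! i - m)))"
    using assms unfolding homog_comb_def by blast
  from bchoice[OF this] obtain c where c: "\<And>i. i < length d \<Longrightarrow>
      u i = (\<Sum>m\<le>d ! i. rat_const (c i m) * (Var i ^ m * (1 - Var i) ^ (d ! i - m)))"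
    by blast
  define b where "b i m = c i m / of_nat (d ! i choose m)" for i m
  have fac: "rat_const (c i m) = rat_const (b i m) * Const (real (d ! i choose m))" if "m \<le> d ! i" for i m
  proof -
    have "of_rat (c i m) = (of_rat (b i m) * real (d ! i choose m))"
      using that by (simp add: b_def of_rat_divide)
    then show ?thesis by (simp only: Const_mult)
  qed
  have "(\<Prod>i<length d. u i) =
        (\<Prod>i<length d. \<Sum>m\<le>d ! i. rat_const (b i m) *
           (Const (real (d ! i choose m)) * Var i ^ m * (1 - Var i) ^ (d ! i - m)))"
    by (intro prod.cong refl) (simp add: c fac mult.assoc)
  also have "\<dots> = (\<Sum>m\<leftarrow>multi_indices d. rat_const (\<Prod>i<length d. b i (m ! i)) * bernstein d m)"
    by (simp only: prod_sum_multi_indices prod.distrib bernstein_def of_rat_prod Const_prod)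
  finally show ?thesis
    unfolding bernstein_span_def by (intro CollectI exI)
qed

lemma box_map_powers_homog_comb:
  assumes "fst (E ! i) = of_rat \<alpha>" "snd (E ! i) = of_rat \<beta>"
  shows "box_map E i ^ s * (1 - box_map E i) ^ t \<in> homog_comb (s + t) (Var i)"
    and "s \<le> e \<Longrightarrow> box_map E i ^ s \<in> homog_comb e (Var i)"
proof -
  have 1: "box_map E i = rat_const \<alpha> + rat_const (\<beta> - \<alpha>) * Var i"
    by (simp add: box_map_def assms of_rat_diff)
  have 2: "1 - box_map E i = rat_const (1 - \<alpha>) + rat_const (\<alpha> - \<beta>) * Var i"
    by (simp add: 1 of_rat_diff Const_diff Const_1 left_diff_distrib)
  show "box_map E i ^ s * (1 - box_map E i) ^ t \<in> homog_comb (s + t) (Var i)"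
    unfolding 2 unfolding 1 by (rule affine_powers_homog_comb)
  show "box_map E i ^ s \<in> homog_comb e (Var i)" if "s \<le> e"
    using affine_powers_homog_comb[of \<alpha> "\<beta> - \<alpha>" "Var i" s 1 0 "e - s"] that
    by (simp add: 1 Const_0 Const_1)
qed

lemma homog_comb_scale:
  assumes "q \<in> homog_comb e X" shows "rat_const a * q \<in> homog_comb e X"
proof -
  obtain c where "q = (\<Sum>m\<le>e. rat_const (c m) * (X ^ m * (1 - X) ^ (e - m)))"
    using assms by (auto simp: homog_comb_def)
  then have "rat_const a * q = (\<Sum>m\<le>e. rat_const (a * c m) * (X ^ m * (1 - X) ^ (e - m)))"
    by (simp add: sum_distrib_left of_rat_mult Const_mult mult.assoc)
  then show ?thesis
    unfolding homog_comb_def by (intro CollectI exI)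
qed

text \<open>
  With the next lemma, this shows that all the polynomials whose coordinates are taken by
  \<open>subst_mat\<close> and \<open>assoc_mat\<close> really have rational coordinates, as long as the box has rational
  end points.
\<close>

lemma bernstein_comp_box_in_span:
  assumes m: "m \<in> set (multi_indices d)"
    and E: "\<And>i. i < length d \<Longrightarrow> fst (E ! i) \<in> \<rat> \<and> snd (E ! i) \<in> \<rat>"
  shows "mpoly_comp (bernstein d m) (box_map E) \<in> bernstein_span d"
proof -
  have "mpoly_comp (bernstein d m) (box_map E) =
    (\<Prod>i<length d. rat_const (of_nat (d ! i choose m ! i)) *
        (box_map E i ^ (m ! i) * (1 - box_map E i) ^ (d ! i - m ! i)))"
    by (simp add: mpoly_comp_def bernstein_def comp_eval.eval_prod comp_eval.eval_mult
        comp_eval.eval_power comp_eval.eval_one_minus comp_eval.eval_Const comp_eval.eval_Var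
        mult.assoc)
  also have "\<dots> \<in> bernstein_span d"
  proof (rule prod_homog_comb_in_span, rule homog_comb_scale)
    fix i assume i: "i < length d"
    obtain \<alpha> \<beta> where "fst (E ! i) = of_rat \<alpha>" "snd (E ! i) = of_rat \<beta>"
      using E[OF i] by (auto elim!: Rats_cases)
    from box_map_powers_homog_comb(1)[OF this, of "m ! i" "d ! i - m ! i"]
    show "box_map E i ^ (m ! i) * (1 - box_map E i) ^ (d ! i - m ! i) \<in> homog_comb (d ! i) (Var i)"
      using le_in_multi_indices[OF m i] by simp
  qed
  finally show ?thesis .
qed

lemma int_mpoly_comp_box_in_span:
  assumes h: "h \<in> mpolys_le d"
    and E: "\<And>i. i < length d \<Longrightarrow> fst (E ! i) \<in> \<rat> \<and> snd (E ! i) \<in> \<rat>"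
  shows "mpoly_comp (real_mpoly h) (box_map E) \<in> bernstein_span d"
  unfolding mpoly_comp_def mpoly_eval_def keys_real_mpoly lookup_real_mpoly
proof (rule bernstein_span_sum)
  fix m assume m: "m \<in> Poly_Mapping.keys h"
  then have keys: "Poly_Mapping.keys m \<subseteq> {..<length d}"
    and deg: "\<And>i. i < length d \<Longrightarrow> Poly_Mapping.lookup m i \<le> d ! i"
    using h by (auto simp: mpolys_le_def)
  have "(\<Prod>i\<in>Poly_Mapping.keys m. box_map E i ^ Poly_Mapping.lookup m i) =
        (\<Prod>i<length d. box_map E i ^ Poly_Mapping.lookup m i)"
    by (rule prod.mono_neutral_left) (use keys in \<open>auto simp: in_keys_iff\<close>)
  also have "\<dots> \<in> bernstein_span d"
  proof (rule prod_homog_comb_in_span)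
    fix i assume i: "i < length d"
    obtain \<alpha> \<beta> where "fst (E ! i) = of_rat \<alpha>" "snd (E ! i) = of_rat \<beta>"
      using E[OF i] by (auto elim!: Rats_cases)
    from box_map_powers_homog_comb(2)[OF this deg[OF i]]
    show "box_map E i ^ Poly_Mapping.lookup m i \<in> homog_comb (d ! i) (Var i)" .
  qed
  finally show "Const (real_of_int (Poly_Mapping.lookup h m)) *
      (\<Prod>i\<in>Poly_Mapping.keys m. box_map E i ^ Poly_Mapping.lookup m i) \<in> bernstein_span d"
    using bernstein_span_scale[of _ d "of_int (Poly_Mapping.lookup h m)"] by simp
qed

section \<open>Coordinates in the Bernstein basis\<close>

definition bernstein_fun :: "nat list \<Rightarrow> nat list \<Rightarrow> (nat \<Rightarrow> real) \<Rightarrow> real" where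
  "bernstein_fun d m x =
     (\<Prod>i<length d. real (d ! i choose m ! i) * x i ^ (m ! i) * (1 - x i) ^ (d ! i - m ! i))"

lemma reval_bernstein: "reval x (bernstein d m) = bernstein_fun d m x"
  by (simp add: bernstein_def bernstein_fun_def real_eval.eval_prod real_eval.eval_mult
      real_eval.eval_power real_eval.eval_one_minus real_eval.eval_Const real_eval.eval_Var)

text \<open>
  Induction on the number of variables: for fixed positive values of the other variables the sum is a
  polynomial in the first variable with infinitely many zeros, so each of its coefficients
  vanishes, and the coefficients are sums of the same kind in one variable less.
\<close>

lemma monomials_independent:
  fixes c :: "nat list \<Rightarrow> real"
  assumes "\<And>t. (\<And>i. t i > 0) \<Longrightarrow>
      (\<Sum>m\<leftarrow>multi_indices d. c m * (\<Prod>i<length d. t i ^ (m ! i))) = 0"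
    and "m \<in> set (multi_indices d)"
  shows "c m = 0"
  using assms
proof (induction d arbitrary: c m)
  case Nil
  then show ?case using Nil(1)[of "\<lambda>_. 1"] by simp
next
  case (Cons e d)
  obtain b m' where m: "m = b # m'" "b \<le> e" "m' \<in> set (multi_indices d)"
    using Cons.prems(2) by fastforce
  have "c (b # m') = 0"
  proof (rule Cons.IH[OF _ m(3), of "\<lambda>m. c (b # m)"])
    fix t :: "nat \<Rightarrow> real"
    assume t: "\<And>i. t i > 0"
    define g where "g b = (\<Sum>m\<leftarrow>multi_indices d. c (b # m) * (\<Prod>i<length d. t i ^ (m ! i)))" for b
    have zero: "(\<Sum>b\<le>e. g b * s ^ b) = 0" if "s > 0" for s
    proof -
      have "(\<Sum>m\<leftarrow>multi_indices (e # d).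
               c m * (\<Prod>i<length (e # d). case_nat s t i ^ (m ! i))) = 0"
        by (rule Cons.prems(1)) (use t that in \<open>auto split: nat.split\<close>)
      moreover have "(\<Sum>m\<leftarrow>multi_indices d.
               c (b # m) * (\<Prod>i<length (e # d). case_nat s t i ^ ((b # m) ! i))) = g b * s ^ b"
        for b
        by (simp add: prod.lessThan_Suc_shift g_def sum_list_const_mult mult_ac
            del: prod.lessThan_Suc)
      ultimately show ?thesis
        by (simp only: sum_list_multi_indices_Cons)
    qed
    have "infinite {s. (\<Sum>b\<le>e. g b * s ^ b) = 0}"
    proof
      assume "finite {s. (\<Sum>b\<le>e. g b * s ^ b) = 0}"
      then have "finite {0::real<..}"
        by (rule rev_finite_subset) (auto simp: zero)
      then show False
        using infinite_Ioi by blast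
    qed
    then have "g b = 0"
      using polyfun_finite_roots[of g e] m(2) by blast
    then show "(\<Sum>m\<leftarrow>multi_indices d. c (b # m) * (\<Prod>i<length d. t i ^ (m ! i))) = 0"
      by (simp add: g_def)
  qed
  then show ?case by (simp add: m)
qed

text \<open>
  The substitution \<open>x = t / (1 + t)\<close>, for which \<open>1 - x = 1 / (1 + t)\<close>, turns all Bernstein
  polynomials into monomials in \<open>t\<close> with a common denominator. Their linear independence is thus
  that of the monomials.
\<close>

lemma bernstein_fun_at_odds:
  assumes m: "m \<in> set (multi_indices d)" and t: "\<And>i. t i > 0"
  shows "bernstein_fun d m (\<lambda>i. t i / (1 + t i)) * (\<Prod>i<length d. (1 + t i) ^ (d ! i)) =
         (\<Prod>i<length d. real (d ! i choose m ! i)) * (\<Prod>i<length d. t i ^ (m ! i))"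
  unfolding bernstein_fun_def prod.distrib[symmetric]
proof (rule prod.cong[OF refl])
  fix i assume "i \<in> {..<length d}"
  then have le: "m ! i \<le> d ! i"
    using le_in_multi_indices[OF m] by simp
  have nz: "1 + t i \<noteq> 0"
    using t[of i] by simp
  have "1 - t i / (1 + t i) = 1 / (1 + t i)"
    using nz by (simp add: field_simps)
  moreover have "(1 + t i) ^ (d ! i) = (1 + t i) ^ (m ! i) * (1 + t i) ^ (d ! i - m ! i)"
    using le by (simp add: power_add[symmetric])
  ultimately show "real (d ! i choose m ! i) * (t i / (1 + t i)) ^ (m ! i) *
         (1 - t i / (1 + t i)) ^ (d ! i - m ! i) * (1 + t i) ^ (d ! i) =
         real (d ! i choose m ! i) * t i ^ (m ! i)"
    using nz by (simp add: power_divide)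
qed

lemma bernstein_fun_independent:
  fixes c :: "nat list \<Rightarrow> real"
  assumes zero: "\<And>x. (\<Sum>m\<leftarrow>multi_indices d. c m * bernstein_fun d m x) = 0"
    and m: "m \<in> set (multi_indices d)"
  shows "c m = 0"
proof -
  let ?C = "\<lambda>m. \<Prod>i<length d. real (d ! i choose m ! i)"
  have "c m * ?C m = 0"
  proof (rule monomials_independent[OF _ m])
    fix t :: "nat \<Rightarrow> real" assume t: "\<And>i. t i > 0"
    have "(\<Sum>m\<leftarrow>multi_indices d. c m * ?C m * (\<Prod>i<length d. t i ^ (m ! i))) =
          (\<Sum>m\<leftarrow>multi_indices d. c m * bernstein_fun d m (\<lambda>i. t i / (1 + t i)) *
              (\<Prod>i<length d. (1 + t i) ^ (d ! i)))"
      by (intro arg_cong[of _ _ sum_list] map_cong refl) (simp only: bernstein_fun_at_odds[OF _ t] mult.assoc)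
    also have "\<dots> = 0"
      by (simp only: sum_list_mult_const zero)
    finally show "(\<Sum>m\<leftarrow>multi_indices d. c m * ?C m * (\<Prod>i<length d. t i ^ (m ! i))) = 0" .
  qed
  moreover have "?C m \<noteq> 0"
    using le_in_multi_indices[OF m] by (auto simp: not_less)
  ultimately show ?thesis by simp
qed

lemma length_multi_indices_bdim: "length (multi_indices d) = bdim d"
  by (simp add: length_multi_indices bdim_def)

lemma distinct_multi_indices: "distinct (multi_indices d)"
  unfolding distinct_conv_nth
proof (intro allI impI)
  fix a b assume ab: "a < length (multi_indices d)" "b < length (multi_indices d)" "a \<noteq> b"
  have irrefl: "(xs, xs) \<notin> lexord {(x :: nat, y). x < y}" for xs
    by (rule lexord_irreflexive) auto
  have "(multi_indices d ! a', multi_indices d ! b') \<in> lexord {(x, y). x < y}"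
    if "a' < b'" "b' < length (multi_indices d)" for a' b'
    using sorted_wrt_nth_less[OF sorted_multi_indices that] .
  from this[of a b] this[of b a] show "multi_indices d ! a \<noteq> multi_indices d ! b"
    using ab irrefl by (metis linorder_neqE_nat)
qed

lemma sum_list_conv_sum_bdim:
  fixes f :: "nat list \<Rightarrow> 'a::comm_monoid_add"
  shows "(\<Sum>m\<leftarrow>multi_indices d. f m) = (\<Sum>a<bdim d. f (multi_indices d ! a))"
  by (simp add: sum_list_sum_nth length_multi_indices_bdim atLeast0LessThan)

text \<open>
  A left inverse of the lexicographic enumeration, used to regard a coordinate vector as a function
  of the multi-index.
\<close>

lemma multi_indices_index:
  obtains idx where "\<And>a. a < bdim d \<Longrightarrow> idx (multi_indices d ! a) = a"
proof
  fix a assume "a < bdim d"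
  then show "(THE b. b < bdim d \<and> multi_indices d ! b = multi_indices d ! a) = a"
    using distinct_multi_indices[of d]
    by (intro the_equality) (auto simp: nth_eq_iff_index_eq length_multi_indices_bdim)
qed

lemma bernstein_basis_coords_unique:
  assumes c: "c \<in> carrier_vec (bdim d)" and c': "c' \<in> carrier_vec (bdim d)"
    and eq: "(\<Sum>a<bdim d. rat_const (c $ a) * bernstein_basis d a) =
             (\<Sum>a<bdim d. rat_const (c' $ a) * bernstein_basis d a)"
  shows "c = c'"
proof (rule eq_vecI)
  obtain idx where idx: "\<And>a. a < bdim d \<Longrightarrow> idx (multi_indices d ! a) = a"
    using multi_indices_index by blast
  define e where "e m = (of_rat (c $ idx m) - of_rat (c' $ idx m) :: real)" for m
  fix a assume "a < dim_vec c'"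
  then have a: "a < bdim d" using c' by simp
  have "e (multi_indices d ! a) = 0"
  proof (rule bernstein_fun_independent)
    fix x
    have "(\<Sum>a<bdim d. of_rat (c $ a) * bernstein_fun d (multi_indices d ! a) x) =
          (\<Sum>a<bdim d. of_rat (c' $ a) * bernstein_fun d (multi_indices d ! a) x)"
      using arg_cong[OF eq, of "reval x"]
      by (simp add: real_eval.eval_sum real_eval.eval_mult real_eval.eval_Const
          bernstein_basis_def reval_bernstein)
    then have "(\<Sum>a<bdim d. e (multi_indices d ! a) * bernstein_fun d (multi_indices d ! a) x) = 0"
      by (simp add: e_def idx left_diff_distrib sum_subtractf)
    then show "(\<Sum>m\<leftarrow>multi_indices d. e m * bernstein_fun d m x) = 0"
      by (simp only: sum_list_conv_sum_bdim)
  qed (use a in \<open>simp add: length_multi_indices_bdim\<close>)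
  then show "c $ a = c' $ a"
    by (simp add: e_def idx[OF a])
qed (use c c' in simp)

text \<open>
  Existence of the coordinates comes from the rational span and uniqueness from linear
  independence, so the definite description in \<open>bernstein_coords\<close> denotes the coordinates.
\<close>

lemma bernstein_coords_eq:
  assumes "q \<in> bernstein_span d"
  shows "q = (\<Sum>a<bdim d. rat_const (bernstein_coords d q $ a) * bernstein_basis d a)"
proof -
  let ?P = "\<lambda>c. c \<in> carrier_vec (bdim d) \<and> q = (\<Sum>a<bdim d. rat_const (c $ a) * bernstein_basis d a)"
  obtain c where "q = (\<Sum>m\<leftarrow>multi_indices d. rat_const (c m) * bernstein d m)"
    using assms unfolding bernstein_span_def by blast
  then have P: "?P (vec (bdim d) (\<lambda>a. c (multi_indices d ! a)))"
    by (simp add: sum_list_conv_sum_bdim bernstein_basis_def)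
  have "\<exists>!c. ?P c"
  proof (rule ex1I[of ?P, OF P])
    fix c' assume P': "?P c'"
    show "c' = vec (bdim d) (\<lambda>a. c (multi_indices d ! a))"
      by (rule bernstein_basis_coords_unique[OF conjunct1[OF P'] conjunct1[OF P]])
         (rule trans[OF conjunct2[OF P', symmetric] conjunct2[OF P]])
  qed
  from theI'[OF this] show ?thesis
    unfolding bernstein_coords_def by blast
qed

lemma bernstein_coords_value:
  assumes "q \<in> bernstein_span d"
  shows "(\<Sum>a<bdim d. of_rat (bernstein_coords d q $ a) * bernstein_fun d (multi_indices d ! a) x) = reval x q"
  by (subst (2) bernstein_coords_eq[OF assms])
     (simp add: real_eval.eval_sum real_eval.eval_mult real_eval.eval_Const
        bernstein_basis_def reval_bernstein)

section \<open>Bernstein polynomials on the unit cube\<close>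

lemma bernstein_fun_nonneg: "(\<And>i. i < length d \<Longrightarrow> 0 \<le> x i \<and> x i \<le> 1) \<Longrightarrow> bernstein_fun d m x \<ge> 0"
  unfolding bernstein_fun_def by (intro prod_nonneg) simp

text \<open>
  The product over the variables of the binomial expansions of \<open>(x\<^sub>i + (1 - x\<^sub>i)) ^ d\<^sub>i = 1\<close>.
\<close>

lemma sum_bernstein_fun: "(\<Sum>a<bdim d. bernstein_fun d (multi_indices d ! a) x) = 1"
proof -
  have "(\<Sum>m\<leftarrow>multi_indices d. bernstein_fun d m x) = (\<Prod>i<length d. (x i + (1 - x i)) ^ (d ! i))"
    by (simp only: bernstein_fun_def binomial_ring prod_sum_multi_indices)
  then show ?thesis
    by (simp add: sum_list_conv_sum_bdim)
qed

lemma bdim_pos: "bdim d > 0"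
  by (induction d) (simp_all add: bdim_def)

lemma multi_indices_0: "multi_indices d ! 0 = replicate (length d) 0"
proof (induction d)
  case (Cons e d)
  have "multi_indices d \<noteq> []"
    using bdim_pos[of d] length_multi_indices_bdim[of d] by auto
  then show ?case
    using Cons by (simp add: nth_append upt_conv_Cons del: upt_Suc)
qed simp

text \<open>
  The multi-index \<open>0\<close> comes first, and its Bernstein polynomial is the only one that does not
  vanish at the corner \<open>0\<close>. Hence the first coordinate of a polynomial is its value there.
\<close>

lemma bernstein_fun_at_0:
  assumes a: "a < bdim d"
  shows "bernstein_fun d (multi_indices d ! a) (\<lambda>_. 0) = (if a = 0 then 1 else 0)"
proof (cases "a = 0")
  case True
  then show ?thesis by (simp add: multi_indices_0 bernstein_fun_def)
next
  case False
  let ?m = "multi_indices d ! a"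
  have m: "?m \<in> set (multi_indices d)"
    using a by (simp add: length_multi_indices_bdim)
  have "?m \<noteq> replicate (length d) 0"
    using False a bdim_pos[of d] distinct_multi_indices[of d]
    by (simp add: multi_indices_0[symmetric] nth_eq_iff_index_eq length_multi_indices_bdim)
  moreover have "?m = replicate (length d) 0" if "\<forall>i<length d. ?m ! i = 0"
    using that length_in_multi_indices[OF m] by (intro nth_equalityI) auto
  ultimately obtain i where "i < length d" "?m ! i \<noteq> 0"
    by blast
  then show ?thesis
    using False by (auto simp: bernstein_fun_def intro!: bexI[of _ i])
qed

lemma bernstein_hull:
  fixes c :: "nat \<Rightarrow> real"
  assumes x: "\<And>i. i < length d \<Longrightarrow> 0 \<le> x i \<and> x i \<le> 1"
    and c: "\<And>a. a < bdim d \<Longrightarrow> lo \<le> c a \<and> c a \<le> hi"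
  shows "lo \<le> (\<Sum>a<bdim d. c a * bernstein_fun d (multi_indices d ! a) x)"
    and "(\<Sum>a<bdim d. c a * bernstein_fun d (multi_indices d ! a) x) \<le> hi"
proof -
  have "(\<Sum>a<bdim d. lo * bernstein_fun d (multi_indices d ! a) x) \<le>
        (\<Sum>a<bdim d. c a * bernstein_fun d (multi_indices d ! a) x)"
    using c by (intro sum_mono mult_right_mono bernstein_fun_nonneg x) auto
  then show "lo \<le> (\<Sum>a<bdim d. c a * bernstein_fun d (multi_indices d ! a) x)"
    by (simp add: sum_distrib_left[symmetric] sum_bernstein_fun)
  have "(\<Sum>a<bdim d. c a * bernstein_fun d (multi_indices d ! a) x) \<le>
        (\<Sum>a<bdim d. hi * bernstein_fun d (multi_indices d ! a) x)"
    using c by (intro sum_mono mult_right_mono bernstein_fun_nonneg x) auto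
  then show "(\<Sum>a<bdim d. c a * bernstein_fun d (multi_indices d ! a) x) \<le> hi"
    by (simp add: sum_distrib_left[symmetric] sum_bernstein_fun)
qed

section \<open>Matrix columns as functions, and bisection\<close>

text \<open>
  The function whose Bernstein coordinates form column \<open>i\<close> of \<open>w\<close>. From here on the
  matrices are only ever compared through these functions.
\<close>

definition column_fun :: "nat list \<Rightarrow> rat mat \<Rightarrow> nat \<Rightarrow> (nat \<Rightarrow> real) \<Rightarrow> real" where
  "column_fun d w i x = (\<Sum>a<bdim d. of_rat (w $$ (a, i)) * bernstein_fun d (multi_indices d ! a) x)"

definition rational_box :: "nat \<Rightarrow> box \<Rightarrow> bool" where
  "rational_box n E \<longleftrightarrow> (\<forall>i<n. fst (E ! i) \<in> \<rat> \<and> snd (E ! i) \<in> \<rat>)"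

lemma column_fun_assoc_mat:
  assumes "i < length hs" "hs ! i \<in> mpolys_le d" "rational_box (length d) D"
  shows "column_fun d (assoc_mat d D hs) i x = ieval (\<lambda>j. reval x (box_map D j)) (hs ! i)"
proof -
  have "mpoly_comp (real_mpoly (hs ! i)) (box_map D) \<in> bernstein_span d"
    using assms by (intro int_mpoly_comp_box_in_span) (auto simp: rational_box_def)
  from bernstein_coords_value[OF this, of x] show ?thesis
    using assms(1) by (simp add: column_fun_def assoc_mat_def reval_mpoly_comp reval_real_mpoly)
qed

text \<open>
  The column \<open>b\<close> of \<open>subst_mat d E\<close> holds the coordinates of the composition of the basis
  polynomial \<open>b\<close> with the parametrization of \<open>E\<close>, so multiplying by the matrix composes every
  column function with that parametrization.
\<close>

lemma column_fun_subst_mat: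
  assumes w: "w \<in> carrier_mat (bdim d) r" and i: "i < r" and E: "rational_box (length d) E"
  shows "column_fun d (subst_mat d E * w) i x = column_fun d w i (\<lambda>j. reval x (box_map E j))"
proof -
  let ?M = "subst_mat d E"
  have entry: "(?M * w) $$ (a, i) = (\<Sum>b<bdim d. ?M $$ (a, b) * w $$ (b, i))" if "a < bdim d" for a
    using that w i by (simp add: scalar_prod_def subst_mat_def atLeast0LessThan)
  have column: "(\<Sum>a<bdim d. of_rat (?M $$ (a, b)) * bernstein_fun d (multi_indices d ! a) x) =
      bernstein_fun d (multi_indices d ! b) (\<lambda>j. reval x (box_map E j))" if b: "b < bdim d" for b
  proof -
    have "mpoly_comp (bernstein_basis d b) (box_map E) \<in> bernstein_span d"
      unfolding bernstein_basis_def
      using E b by (intro bernstein_comp_box_in_span) (auto simp: rational_box_def length_multi_indices_bdim)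
    from bernstein_coords_value[OF this, of x] show ?thesis
      using b by (simp add: subst_mat_def reval_mpoly_comp bernstein_basis_def reval_bernstein)
  qed
  have "column_fun d (?M * w) i x =
      (\<Sum>a<bdim d. \<Sum>b<bdim d. of_rat (w $$ (b, i)) *
         (of_rat (?M $$ (a, b)) * bernstein_fun d (multi_indices d ! a) x))"
    unfolding column_fun_def
    by (intro sum.cong refl) (simp add: entry of_rat_sum of_rat_mult sum_distrib_left mult_ac)
  also have "\<dots> = (\<Sum>b<bdim d. of_rat (w $$ (b, i)) *
         (\<Sum>a<bdim d. of_rat (?M $$ (a, b)) * bernstein_fun d (multi_indices d ! a) x))"
    by (subst sum.swap) (simp only: sum_distrib_left)
  also have "\<dots> = column_fun d w i (\<lambda>j. reval x (box_map E j))"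
    unfolding column_fun_def by (intro sum.cong refl) (simp add: column)
  finally show ?thesis .
qed

lemma column_fun_at_0: "column_fun d w i (\<lambda>_. 0) = of_rat (w $$ (0, i))"
proof -
  have "column_fun d w i (\<lambda>_. 0) = (\<Sum>a<bdim d. if a = 0 then of_rat (w $$ (a, i)) else 0)"
    unfolding column_fun_def by (intro sum.cong refl) (simp add: bernstein_fun_at_0)
  then show ?thesis
    using bdim_pos[of d] by simp
qed

lemma column_fun_between:
  assumes w: "w \<in> carrier_mat (bdim d) r" and i: "i < r"
    and x: "\<And>j. j < length d \<Longrightarrow> 0 \<le> x j \<and> x j \<le> 1"
  shows "of_rat (Min (vec_set (col w i))) \<le> column_fun d w i x"
    and "column_fun d w i x \<le> of_rat (Max (vec_set (col w i)))"
proof -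
  have "vec_set (col w i) = (\<lambda>a. w $$ (a, i)) ` {..<bdim d}"
    using w i by (auto simp: vec_set_def)
  then have "of_rat (Min (vec_set (col w i))) \<le> (of_rat (w $$ (a, i)) :: real) \<and>
      (of_rat (w $$ (a, i)) :: real) \<le> of_rat (Max (vec_set (col w i)))" if "a < bdim d" for a
    using that by (simp add: of_rat_less_eq)
  from bernstein_hull[of d x "of_rat (Min (vec_set (col w i)))" "\<lambda>a. of_rat (w $$ (a, i))"
      "of_rat (Max (vec_set (col w i)))", OF x this]
  show "of_rat (Min (vec_set (col w i))) \<le> column_fun d w i x"
    and "column_fun d w i x \<le> of_rat (Max (vec_set (col w i)))"
    by (simp_all add: column_fun_def)
qed

text \<open>
  The invariant of the recursion: column \<open>i\<close> is the polynomial \<open>hs ! i\<close> on the box with sides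
  \<open>[2\<^sup>k l, 2\<^sup>k (l + 1)]\<close>, one \<open>k\<close> and \<open>l\<close> for each variable, transported to the unit cube.
\<close>

definition represents ::
  "nat list \<Rightarrow> int mpoly list \<Rightarrow> rat mat \<Rightarrow> nat list \<Rightarrow> int list \<Rightarrow> bool" where
  "represents d hs w k l \<longleftrightarrow>
     w \<in> carrier_mat (bdim d) (length hs) \<and> length k = length d \<and> length l = length d \<and>
     (\<forall>i<length hs. \<forall>x. column_fun d w i x = ieval (\<lambda>j. 2 ^ (k ! j) * (real_of_int (l ! j) + x j)) (hs ! i))"

text \<open>
  Both halves at once: \<open>\<alpha> = 0\<close> and \<open>c = 0\<close> give the left half, \<open>\<alpha> = 1/2\<close> and \<open>c = 1\<close> the right one.
  In the coordinate that is bisected the new box is consistent with \<open>k - 1\<close> and \<open>2 l + c\<close>, since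
  \<open>2\<^sup>k (l + \<alpha> + x / 2) = 2\<^sup>k\<^sup>-\<^sup>1 (2 l + c + x)\<close>.
\<close>

lemma represents_half:
  assumes rep: "represents d hs w k l" and hs: "\<And>i. i < length hs \<Longrightarrow> hs ! i \<in> mpolys_le d"
    and j: "j < length k" "k ! j > 0" and \<alpha>: "real_of_int c = 2 * \<alpha>"
  shows "represents d hs (subst_mat d ((replicate (length d) (0, 1))[j := (\<alpha>, \<alpha> + 1/2)]) * w)
           (k[j := k ! j - 1]) (l[j := l ! j + l ! j + c])"
proof -
  let ?E = "(replicate (length d) (0, 1))[j := (\<alpha>, \<alpha> + 1/2)]"
  have w: "w \<in> carrier_mat (bdim d) (length hs)" and len: "length k = length d" "length l = length d"
    and val: "\<And>i x. i < length hs \<Longrightarrow>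
      column_fun d w i x = ieval (\<lambda>j. 2 ^ (k ! j) * (real_of_int (l ! j) + x j)) (hs ! i)"
    using rep by (auto simp: represents_def)
  have "of_int c / 2 \<in> (\<rat> :: real set)"
    by simp
  then have "\<alpha> \<in> \<rat>"
    by (simp add: \<alpha>)
  then have "\<alpha> + 1 / 2 \<in> \<rat>"
    by simp
  with \<open>\<alpha> \<in> \<rat>\<close> have E: "rational_box (length d) ?E"
    using j(1) len by (simp add: rational_box_def nth_list_update)
  have coord: "2 ^ (k ! b) * (real_of_int (l ! b) + reval x (box_map ?E b)) =
      2 ^ (k[j := k ! j - 1] ! b) * (real_of_int (l[j := l ! j + l ! j + c] ! b) + x b)"
    if b: "b < length d" for b x
  proof (cases "b = j")
    case True
    obtain K where "k ! j = Suc K"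
      using j(2) gr0_conv_Suc by blast
    then show ?thesis
      using True b len \<alpha> by (simp add: reval_box_map algebra_simps)
  next
    case False
    then show ?thesis
      using b by (simp add: reval_box_map)
  qed
  show ?thesis
    unfolding represents_def
  proof (intro conjI allI impI)
    show "subst_mat d ?E * w \<in> carrier_mat (bdim d) (length hs)"
      using w by (auto simp: subst_mat_def)
    fix i x assume i: "i < length hs"
    show "column_fun d (subst_mat d ?E * w) i x =
        ieval (\<lambda>b. 2 ^ (k[j := k ! j - 1] ! b) * (real_of_int (l[j := l ! j + l ! j + c] ! b) + x b)) (hs ! i)"
      unfolding column_fun_subst_mat[OF w i E] val[OF i]
      by (rule ieval_cong[OF hs[OF i]]) (rule coord)
  qed (use len in simp_all)
qed

lemma represents_M_left:
  assumes "represents d hs w k l" "\<And>i. i < length hs \<Longrightarrow> hs ! i \<in> mpolys_le d"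
    "j < length k" "k ! j > 0"
  shows "represents d hs (M_left d j * w) (k[j := k ! j - 1]) (l[j := l ! j + l ! j])"
  using represents_half[OF assms, of 0 0] by (simp add: M_left_def)

lemma represents_M_right:
  assumes "represents d hs w k l" "\<And>i. i < length hs \<Longrightarrow> hs ! i \<in> mpolys_le d"
    "j < length k" "k ! j > 0"
  shows "represents d hs (M_right d j * w) (k[j := k ! j - 1]) (l[j := l ! j + l ! j + 1])"
  using represents_half[OF assms, of 1 "1/2"] by (simp add: M_right_def)

section \<open>Correctness of the algorithm\<close>

text \<open>
  The integer points for which the call with parameters \<open>k\<close> and \<open>l\<close> is responsible. Half-open
  sides make the cells of the two recursive calls a partition of the cell of the call.
\<close>

definition cell :: "nat list \<Rightarrow> int list \<Rightarrow> int list set" where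
  "cell k l = {z. length z = length l \<and>
     (\<forall>j<length l. 2 ^ (k ! j) * l ! j \<le> z ! j \<and> z ! j < 2 ^ (k ! j) * (l ! j + 1))}"

lemma cell_split:
  assumes j: "j < length l" "length k = length l" "k ! j > 0"
  shows "cell k l = cell (k[j := k ! j - 1]) (l[j := l ! j + l ! j]) \<union>
                    cell (k[j := k ! j - 1]) (l[j := l ! j + l ! j + 1])"
proof -
  obtain K where K: "k ! j = Suc K"
    using j(3) gr0_conv_Suc by blast
  define rest where "rest z \<longleftrightarrow> length z = length l \<and>
      (\<forall>b<length l. b \<noteq> j \<longrightarrow> 2 ^ (k ! b) * l ! b \<le> z ! b \<and> z ! b < 2 ^ (k ! b) * (l ! b + 1))" for z
  have mem: "z \<in> cell k' l' \<longleftrightarrow>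
      2 ^ (k' ! j) * l' ! j \<le> z ! j \<and> z ! j < 2 ^ (k' ! j) * (l' ! j + 1) \<and> rest z"
    if "length l' = length l" "\<And>b. b \<noteq> j \<Longrightarrow> k' ! b = k ! b" "\<And>b. b \<noteq> j \<Longrightarrow> l' ! b = l ! b"
    for z k' l'
  proof -
    have "(\<forall>b<length l. P b) \<longleftrightarrow> P j \<and> (\<forall>b<length l. b \<noteq> j \<longrightarrow> P b)" for P
      using j(1) by blast
    from this[of "\<lambda>b. 2 ^ (k' ! b) * l' ! b \<le> z ! b \<and> z ! b < 2 ^ (k' ! b) * (l' ! b + 1)"]
    show ?thesis
      using that by (auto simp: cell_def rest_def)
  qed
  have parent: "z \<in> cell k l \<longleftrightarrow>
      2 ^ Suc K * l ! j \<le> z ! j \<and> z ! j < 2 ^ Suc K * (l ! j + 1) \<and> rest z" for z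
    using mem[of l k z] by (simp only: K)
  have child: "z \<in> cell (k[j := k ! j - 1]) (l[j := a]) \<longleftrightarrow>
      2 ^ K * a \<le> z ! j \<and> z ! j < 2 ^ K * (a + 1) \<and> rest z" for z a
    using mem[of "l[j := a]" "k[j := k ! j - 1]" z] j K by simp
  have halves: "2 ^ Suc K * a \<le> y \<and> y < 2 ^ Suc K * (a + 1) \<longleftrightarrow>
     2 ^ K * (a + a) \<le> y \<and> y < 2 ^ K * (a + a + 1) \<or>
     2 ^ K * (a + a + 1) \<le> y \<and> y < 2 ^ K * (a + a + 1 + 1)" for a y :: int
  proof -
    define P q where "P = (2::int) ^ K" and "q = P * a"
    have "P > 0" by (simp add: P_def)
    moreover have "2 ^ Suc K * a = q + q" "2 ^ Suc K * (a + 1) = q + q + P + P"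
      "2 ^ K * (a + a) = q + q" "2 ^ K * (a + a + 1) = q + q + P"
      "2 ^ K * (a + a + 1 + 1) = q + q + P + P"
      by (simp_all add: P_def q_def algebra_simps)
    ultimately show ?thesis by arith
  qed
  show ?thesis
    using halves[of "l ! j"] by (auto simp only: parent child Un_iff set_eq_iff)
qed

text \<open>
  A multiple of \<open>p\<close> between the rounded bounds lies strictly above the lower one if that has a
  positive remainder. If in addition the upper remainder is not smaller than the lower one, then
  at least \<open>p\<close> separates the bounds.
\<close>

lemma hasSol_if_multiple:
  assumes h: "of_rat m\<^sub>1 \<le> real_of_int h" "real_of_int h \<le> of_rat m\<^sub>2" and p: "p dvd h" "p \<ge> 2"
  shows "hasSol m\<^sub>1 m\<^sub>2 p"
proof -
  let ?a = "\<lceil>m\<^sub>1\<rceil>" and ?b = "\<lfloor>m\<^sub>2\<rfloor>"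
  have "of_rat m\<^sub>1 \<le> (of_rat (of_int h) :: real)" "(of_rat (of_int h) :: real) \<le> of_rat m\<^sub>2"
    using h by simp_all
  then have ab: "?a \<le> h" "h \<le> ?b"
    by (simp_all only: of_rat_less_eq ceiling_le_iff le_floor_iff)
  obtain t where t: "h = p * t"
    using p(1) by blast
  have False if less: "?b - ?a < p - 1" and r: "0 < ?a mod p" "?a mod p \<le> ?b mod p"
  proof -
    have a: "?a = p * (?a div p) + ?a mod p" and b: "?b = p * (?b div p) + ?b mod p"
      by simp_all
    have "p * (?a div p) < p * t"
      using a ab(1) r(1) t by linarith
    moreover have "p * t < p * (?b div p + 1)"
      unfolding distrib_left mult_1_right
      using b ab(2) t pos_mod_bound[of p ?b] p(2) by linarith
    ultimately have "?a div p < t" "t < ?b div p + 1"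
      using p(2) by simp_all
    then have "p * (?a div p + 1) \<le> p * (?b div p)"
      using p(2) by (intro mult_left_mono) auto
    then show False
      unfolding distrib_left mult_1_right
      using a b less r(2) by linarith
  qed
  then show ?thesis
    by (auto simp: hasSol_def Let_def)
qed

definition sols :: "int mpoly list \<Rightarrow> int list \<Rightarrow> int list set" where
  "sols hs ps = {z. \<forall>i<length ps. ps ! i dvd eval_int (hs ! i) z}"

text \<open>
  Pruning loses no solution: at a solution in the cell every \<open>hs ! i\<close> takes a value that is a
  multiple of \<open>ps ! i\<close>, and by the convex hull property this value lies between the extreme
  entries of the column.
\<close>

lemma all_hasSol_if_solution:
  assumes rep: "represents d hs w k l" and hs: "\<And>i. i < length hs \<Longrightarrow> hs ! i \<in> mpolys_le d"
    and ps: "length ps = length hs" "\<And>i. i < length ps \<Longrightarrow> ps ! i \<ge> 2"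
    and z: "z \<in> cell k l" "z \<in> sols hs ps"
  shows "all_hasSol ps w"
  unfolding all_hasSol_def
proof (intro allI impI)
  fix i assume i: "i < length ps"
  have w: "w \<in> carrier_mat (bdim d) (length ps)" and len: "length k = length d" "length l = length d"
    and val: "\<And>x. column_fun d w i x = ieval (\<lambda>j. 2 ^ (k ! j) * (real_of_int (l ! j) + x j)) (hs ! i)"
    using rep i ps(1) by (auto simp: represents_def)
  \<comment> \<open>The parameter of \<open>z\<close> in the unit cube.\<close>
  define x where "x j = real_of_int (z ! j) / 2 ^ (k ! j) - real_of_int (l ! j)" for j
  have "column_fun d w i x = ieval (\<lambda>j. real_of_int (z ! j)) (hs ! i)"
    unfolding val x_def by (simp add: algebra_simps)
  then have eq: "column_fun d w i x = real_of_int (eval_int (hs ! i) z)"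
    by (simp only: ieval_of_int)
  have x: "0 \<le> x j \<and> x j \<le> 1" if "j < length d" for j
  proof -
    have "2 ^ (k ! j) * l ! j \<le> z ! j" "z ! j \<le> 2 ^ (k ! j) * (l ! j + 1)"
      using z(1) that len by (auto simp: cell_def less_imp_le)
    then have "real_of_int (2 ^ (k ! j) * l ! j) \<le> real_of_int (z ! j)"
      "real_of_int (z ! j) \<le> real_of_int (2 ^ (k ! j) * (l ! j + 1))"
      by (simp_all only: of_int_le_iff)
    then show ?thesis
      by (simp add: x_def field_simps)
  qed
  show "hasSol (Min (vec_set (col w i))) (Max (vec_set (col w i))) (ps ! i)"
  proof (rule hasSol_if_multiple)
    show "ps ! i dvd eval_int (hs ! i) z"
      using z(2) i by (simp add: sols_def)
  qed (use column_fun_between[OF w i, of x] x eq ps(2)[OF i] in simp_all)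
qed

lemma cell_0:
  assumes "length k = length l" "\<forall>x\<in>set k. x = 0"
  shows "cell k l = {l}"
proof -
  have k: "k ! j = 0" if "j < length l" for j
    using assms that by (metis nth_mem)
  have "(a \<le> b \<and> b < a + 1) \<longleftrightarrow> b = a" for a b :: int
    by arith
  then have "cell k l = {z. length z = length l \<and> (\<forall>j<length l. z ! j = l ! j)}"
    by (simp add: cell_def k)
  then show ?thesis
    by (auto intro: nth_equalityI)
qed

text \<open>
  On a cell of side \<open>1\<close> the divisibility test reads off the value of \<open>hs ! i\<close> at the corner \<open>l\<close>, the
  only integer point of the cell.
\<close>

lemma int_dvd_rat_corner:
  assumes rep: "represents d hs w k l" and hs: "hs ! i \<in> mpolys_le d"
    and k: "\<forall>x\<in>set k. x = 0" and i: "i < length hs"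
  shows "int_dvd_rat p (w $$ (0, i)) \<longleftrightarrow> p dvd eval_int (hs ! i) l"
proof -
  have k0: "k ! j = 0" if "j < length d" for j
    using rep k that by (metis nth_mem represents_def)
  have "of_rat (w $$ (0, i)) = column_fun d w i (\<lambda>_. 0)"
    by (simp only: column_fun_at_0)
  also have "\<dots> = ieval (\<lambda>j. 2 ^ (k ! j) * (real_of_int (l ! j) + 0)) (hs ! i)"
    using rep i by (simp add: represents_def)
  also have "\<dots> = ieval (\<lambda>j. real_of_int (l ! j)) (hs ! i)"
    by (rule ieval_cong[OF hs]) (simp add: k0)
  also have "\<dots> = of_rat (of_int (eval_int (hs ! i) l))"
    by (simp add: ieval_of_int)
  finally have "w $$ (0, i) = of_int (eval_int (hs ! i) l)"
    by (simp only: of_rat_eq_iff)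
  then show ?thesis
    by (simp add: int_dvd_rat_def)
qed

text \<open>
  The induction is over an arbitrary run, so the result does not depend on the choices of a
  maximal index.
\<close>

lemma SolveCE_result:
  assumes "SolveCE d ps w k l S S'" and "represents d hs w k l"
    and hs: "\<And>i. i < length hs \<Longrightarrow> hs ! i \<in> mpolys_le d"
    and ps: "length ps = length hs" "\<And>i. i < length ps \<Longrightarrow> ps ! i \<ge> 2"
  shows "S' = S \<union> (cell k l \<inter> sols hs ps)"
  using assms(1,2)
proof (induction rule: SolveCE.induct)
  case (prune w k l S)
  then show ?case
    using all_hasSol_if_solution[OF prune(2) hs ps] by blast
next
  case (split w j k l S S' S'')
  have "cell k l = cell (k[j := k ! j - 1]) (l[j := l ! j + l ! j]) \<union>
                   cell (k[j := k ! j - 1]) (l[j := l ! j + l ! j + 1])"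
    using split.hyps split.prems by (intro cell_split) (simp_all add: represents_def)
  moreover have "S' = S \<union> (cell (k[j := k ! j - 1]) (l[j := l ! j + l ! j]) \<inter> sols hs ps)"
    by (rule split.IH(1)) (rule represents_M_left[OF split.prems hs split.hyps(2,4)])
  moreover have "S'' = S' \<union> (cell (k[j := k ! j - 1]) (l[j := l ! j + l ! j + 1]) \<inter> sols hs ps)"
    by (rule split.IH(2)) (rule represents_M_right[OF split.prems hs split.hyps(2,4)])
  ultimately show ?case
    by blast
next
  case (accept w k l S)
  have "l \<in> sols hs ps"
    using accept.hyps(3) int_dvd_rat_corner[OF accept.prems hs accept.hyps(2)] ps(1)
    by (simp add: sols_def)
  moreover have "cell k l = {l}"
    using accept.prems accept.hyps(2) by (intro cell_0) (simp_all add: represents_def)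
  ultimately show ?case
    by blast
next
  case (reject w k l S)
  have "l \<notin> sols hs ps"
    using reject.hyps(3) int_dvd_rat_corner[OF reject.prems hs reject.hyps(2)] ps(1)
    by (simp add: sols_def)
  moreover have "cell k l = {l}"
    using reject.prems reject.hyps(2) by (intro cell_0) (simp_all add: represents_def)
  ultimately show ?case
    by simp
qed

text \<open>
  Each recursive call lowers the sum of the entries of \<open>k\<close> by one. Existence of a run is what
  turns the previous lemma into an equivalence.
\<close>

lemma SolveCE_terminates: "\<exists>S'. SolveCE d ps w k l S S'"
proof (induction "sum_list k" arbitrary: w k l S rule: less_induct)
  case less
  consider "\<not> all_hasSol ps w" | "all_hasSol ps w" "\<forall>x\<in>set k. x = 0"
    | "all_hasSol ps w" "\<exists>x\<in>set k. x > 0"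
    using gr0I by metis
  then show ?case
  proof cases
    case 1
    then show ?thesis by (blast intro: SolveCE.prune)
  next
    case 2
    then show ?thesis by (blast intro: SolveCE.accept SolveCE.reject)
  next
    case 3
    then have "set k \<noteq> {}" "\<exists>x\<in>set k. x > 0"
      by auto
    then have "Max (set k) \<in> set k" "Max (set k) > 0"
      by (simp_all add: Max_gr_iff)
    then obtain j where j: "j < length k" "k ! j = Max (set k)" "k ! j > 0"
      by (metis in_set_conv_nth)
    have "sum_list (k[j := k ! j - 1]) < sum_list k"
      using j elem_le_sum_list[OF j(1)] by (simp add: sum_list_update)
    note IH = less[OF this]
    obtain S' where "SolveCE d ps (M_left d j * w) (k[j := k ! j - 1]) (l[j := l ! j + l ! j]) S S'"
      using IH by blast
    moreover obtain S'' where
      "SolveCE d ps (M_right d j * w) (k[j := k ! j - 1]) (l[j := l ! j + l ! j + 1]) S' S''"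
      using IH by blast
    ultimately show ?thesis
      using SolveCE.split 3(1) j by blast
  qed
qed

lemma represents_assoc_mat:
  assumes hs: "\<And>i. i < length hs \<Longrightarrow> hs ! i \<in> mpolys_le d" and n: "length d = n"
  shows "represents d hs (assoc_mat d (replicate n (0, 2 ^ k)) hs) (replicate n k) (replicate n 0)"
proof -
  let ?D = "replicate n (0, 2 ^ k) :: box"
  have D: "rational_box (length d) ?D"
    using n by (simp add: rational_box_def)
  have "column_fun d (assoc_mat d ?D hs) i x =
      ieval (\<lambda>j. 2 ^ (replicate n k ! j) * (real_of_int (replicate n 0 ! j) + x j)) (hs ! i)"
    if i: "i < length hs" for i x
    unfolding column_fun_assoc_mat[OF i hs[OF i] D]
    by (rule ieval_cong[OF hs[OF i]]) (simp add: reval_box_map n)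
  then show ?thesis
    using n by (simp add: represents_def assoc_mat_def)
qed

theorem theorem4p2:
  fixes d :: "nat list" and hs :: "int mpoly list" and ps :: "int list"
    and n r k :: nat and D :: box and v :: "rat mat"
    and S :: "int list set"
  assumes "length d = n" and "length hs = r" and "length ps = r"
    and "\<forall>i<r. hs ! i \<in> mpolys_le d"
    and "\<forall>i<r. ps ! i \<ge> 2"
    and "k = nat \<lceil>log 2 (real_of_int (Lcm (set ps)))\<rceil>"
    and "D = replicate n (0, 2 ^ k)"
    and "v = assoc_mat d D hs"
  shows "SolveCE d ps v (replicate n k) (replicate n 0) {} S \<longleftrightarrow>
         S = {z. map real_of_int z \<in> box_points D \<and> (\<forall>j<n. z ! j \<noteq> 2 ^ k) \<and>
                 (\<forall>i<r. ps ! i dvd eval_int (hs ! i) z)}"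
proof -
  let ?T = "cell (replicate n k) (replicate n 0) \<inter> sols hs ps"
  have rep: "represents d hs v (replicate n k) (replicate n 0)"
    unfolding assms(7,8) using assms(1,2,4) by (intro represents_assoc_mat) simp_all
  have result: "S' = ?T" if "SolveCE d ps v (replicate n k) (replicate n 0) {} S'" for S'
    using SolveCE_result[OF that rep] assms(2-5) by simp
  then have "SolveCE d ps v (replicate n k) (replicate n 0) {} S \<longleftrightarrow> S = ?T"
    using SolveCE_terminates by metis
  \<comment> \<open>The points of \<open>D\<close> with no coordinate equal to \<open>2 ^ k\<close> form the half-open cell of
      the initial call.\<close>
  moreover have "map real_of_int z \<in> box_points D \<and> (\<forall>j<n. z ! j \<noteq> 2 ^ k) \<longleftrightarrow>
      z \<in> cell (replicate n k) (replicate n 0)" for z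
  proof -
    have "real_of_int a \<le> 2 ^ k \<longleftrightarrow> a \<le> 2 ^ k" for a
      using of_int_le_iff[of a "2 ^ k", where 'a = real] by simp
    then show ?thesis
      unfolding assms(7) cell_def box_points_def by (auto simp: order.strict_iff_order)
  qed
  then have "{z. map real_of_int z \<in> box_points D \<and> (\<forall>j<n. z ! j \<noteq> 2 ^ k) \<and>
                 (\<forall>i<r. ps ! i dvd eval_int (hs ! i) z)} = ?T"
    using assms(3) by (auto simp: sols_def)
  ultimately show ?thesis by simp
qed

end
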